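(* Let $n$ be a positive integer such that $2^{2^n}+1$ is prime. Then the following system in the variables $x_1,\ldots,x_{n+6}$: \[ \begin{array}{rcl} x_i \cdot x_i &=& x_{i+1} \quad \text{for every } i \in \{1,\ldots,n\}, \\ x_{n+2} &=& 1, \\ x_{1}+x_{n+2} &=& x_{n+3}, \\ x_{n+3}+x_{n+2} &=& x_{n+4}, \\ x_{n+1}+x_{n+2} &=& x_{n+5}, \\ x_{n+4} \cdot x_{n+6} &=& x_{n+5} \end{array} \] has a unique solution $(a_1,\ldots,a_{n+6})$ in non-negative integers. The numbers $a_1,\ldots,a_{n+6}$ are positive and $\max(a_1,\ldots,a_{n+6}) = a_{n+5} = \left(2^{2^n}-1\right)^{2^n}+1$. *)

theory Defs
  imports "HOL-Computational_Algebra.Primes" "HOL-Library.FuncSet"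
begin

definition fermat_system :: "nat \<Rightarrow> (nat \<Rightarrow> nat) \<Rightarrow> bool" where
  "fermat_system n x \<longleftrightarrow>
     (\<forall>i\<in>{1..n}. x i * x i = x (i + 1)) \<and>
     x (n + 2) = 1 \<and>
     x 1 + x (n + 2) = x (n + 3) \<and>
     x (n + 3) + x (n + 2) = x (n + 4) \<and>
     x (n + 1) + x (n + 2) = x (n + 5) \<and>
     x (n + 4) * x (n + 6) = x (n + 5)"

text \<open>A tuple \<open>(a\<^sub>1, \<dots>, a\<^bsub>n+6\<^esub>)\<close> is a function that is \<open>undefined\<close> outside
  \<open>{1..n+6}\<close>, so that equality of tuples is equality of functions.\<close>

definition fermat_solutions :: "nat \<Rightarrow> (nat \<Rightarrow> nat) set" where
  "fermat_solutions n = {x \<in> {1..n + 6} \<rightarrow>\<^sub>E UNIV. fermat_system n x}"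

end

theory Submission imports Defs "HOL-Number_Theory.Cong" begin

text \<open>The squarings force \<open>x\<^sub>i = y ^ 2 ^ (i - 1)\<close> with \<open>y = x\<^sub>1\<close>, and the remaining equations are
  solvable exactly when \<open>y + 2\<close> divides \<open>y ^ 2 ^ n + 1\<close>. Since \<open>y \<equiv> -2\<close> modulo \<open>y + 2\<close> and the
  exponent is even, this means that \<open>y + 2\<close> divides the Fermat number \<open>2 ^ 2 ^ n + 1\<close>. If that
  number is prime, then \<open>y + 2\<close>, being greater than 1, equals it.\<close>

text \<open>The tuple is defined for every \<open>y\<close>: the truncating \<open>div\<close> in
  the last entry is exact just when \<open>y + 2\<close> divides \<open>y ^ 2 ^ n + 1\<close>. The
  restricted lambda makes it \<open>undefined\<close> off the index range, as membership in
  \<open>fermat_solutions\<close> demands.\<close>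

definition fermat_tuple :: "nat \<Rightarrow> nat \<Rightarrow> nat \<Rightarrow> nat" where
  "fermat_tuple n y = (\<lambda>i\<in>{1..n + 6}.
     if i \<le> n + 1 then y ^ 2 ^ (i - 1)
     else if i = n + 2 then 1
     else if i = n + 3 then y + 1
     else if i = n + 4 then y + 2
     else if i = n + 5 then y ^ 2 ^ n + 1
     else (y ^ 2 ^ n + 1) div (y + 2))"

lemma fermat_tuple_simps:
  "i \<in> {1..n + 1} \<Longrightarrow> fermat_tuple n y i = y ^ 2 ^ (i - 1)"
  "fermat_tuple n y (n + 2) = 1"
  "fermat_tuple n y (n + 3) = y + 1"
  "fermat_tuple n y (n + 4) = y + 2"
  "fermat_tuple n y (n + 5) = y ^ 2 ^ n + 1"
  "fermat_tuple n y (n + 6) = (y ^ 2 ^ n + 1) div (y + 2)"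
  by (auto simp: fermat_tuple_def)

lemma fermat_index_cases:
  fixes i n :: nat
  assumes "i \<in> {1..n + 6}"
  obtains "i \<in> {1..n + 1}" | "i = n + 2" | "i = n + 3" | "i = n + 4" | "i = n + 5" | "i = n + 6"
proof -
  have "i \<in> {1..n + 1} \<or> i = n + 2 \<or> i = n + 3 \<or> i = n + 4 \<or> i = n + 5 \<or> i = n + 6"
    using assms by auto
  then show thesis using that by blast
qed

lemma add_2_dvd_even_power_plus_1_iff:
  fixes y k :: nat
  assumes "even k"
  shows "y + 2 dvd y ^ k + 1 \<longleftrightarrow> y + 2 dvd 2 ^ k + 1"
proof -
  \<comment> \<open>The detour through the integers makes room for the residue -2.\<close>
  have "[int y = - 2] (mod int (y + 2))"
    by (simp add: cong_iff_dvd_diff add.commute)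
  then have "[int y ^ k + 1 = (- 2) ^ k + 1] (mod int (y + 2))"
    by (intro cong_add cong_pow cong_refl)
  \<comment> \<open>Evenness of \<open>k\<close> removes the sign: (-2)^k = 2^k.\<close>
  then have "[int (y ^ k + 1) = int (2 ^ k + 1)] (mod int (y + 2))"
    using assms by (simp add: add.commute)
  then have "[y ^ k + 1 = 2 ^ k + 1] (mod y + 2)"
    by (simp only: cong_int_iff)
  then show ?thesis
    by (rule cong_dvd_iff)
qed

lemma repeated_squaring:
  fixes x :: "nat \<Rightarrow> nat"
  assumes "\<forall>i\<in>{1..n}. x i * x i = x (i + 1)" "k \<le> n"
  shows "x (k + 1) = x 1 ^ 2 ^ k"
  using assms(2)
proof (induction k)
  case (Suc k)
  have "x (Suc k + 1) = x (k + 1) * x (k + 1)"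
    using assms(1) Suc.prems by simp
  also have "\<dots> = x 1 ^ (2 ^ k + 2 ^ k)"
    using Suc by (simp add: power_add)
  finally show ?case by (simp add: mult_2)
qed simp

lemma fermat_tuple_in_fermat_solutions:
  assumes "n > 0" "y + 2 dvd 2 ^ 2 ^ n + 1"
  shows "fermat_tuple n y \<in> fermat_solutions n"
proof -
  have dvd: "y + 2 dvd y ^ 2 ^ n + 1"
    using assms by (subst add_2_dvd_even_power_plus_1_iff) auto
  have sq: "fermat_tuple n y i * fermat_tuple n y i = fermat_tuple n y (i + 1)"
    if "i \<in> {1..n}" for i
  proof -
    \<comment> \<open>Writing \<open>i\<close> as a successor turns the exponent
      \<open>2 ^ (i - 1)\<close> into \<open>2 ^ j\<close>, free of truncated subtraction.\<close>
    obtain j where "i = Suc j" using \<open>i \<in> {1..n}\<close> by (cases i) auto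
    with that show ?thesis
      by (simp add: fermat_tuple_simps(1) mult_2 flip: power_add)
  qed
  have first: "fermat_tuple n y 1 = y" "fermat_tuple n y (n + 1) = y ^ 2 ^ n"
    by (simp_all add: fermat_tuple_simps(1))
  have "fermat_system n (fermat_tuple n y)"
    unfolding fermat_system_def first fermat_tuple_simps(2-6)
    using sq dvd_mult_div_cancel[OF dvd] by simp
  then show ?thesis
    by (simp add: fermat_solutions_def fermat_tuple_def)
qed

text \<open>The solutions are parametrised by the divisors d > 1 of the Fermat number, with d = y +
  2 and y the first entry. Primality will then leave a single d.\<close>

lemma fermat_solutions_eq:
  assumes "n > 0"
  shows "fermat_solutions n = fermat_tuple n ` {y. y + 2 dvd 2 ^ 2 ^ n + 1}"
proof (intro equalityI subsetI)
  fix x assume x: "x \<in> fermat_solutions n"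
  define y where "y = x 1"
  have ext: "x \<in> {1..n + 6} \<rightarrow>\<^sub>E UNIV" and sys: "fermat_system n x"
    using x by (auto simp: fermat_solutions_def)
  have pow: "x (k + 1) = y ^ 2 ^ k" if "k \<le> n" for k
    using repeated_squaring that sys unfolding fermat_system_def y_def by blast
  have vals: "x (n + 2) = 1" "x (n + 3) = y + 1" "x (n + 4) = y + 2"
      "x (n + 5) = y ^ 2 ^ n + 1"
    using sys pow[of n] by (auto simp: fermat_system_def y_def)
  have last: "(y + 2) * x (n + 6) = y ^ 2 ^ n + 1"
    using sys vals by (metis fermat_system_def)
  \<comment> \<open>Since \<open>n > 0\<close>, the exponent \<open>2 ^ n\<close> is even.\<close>
  then have dvd: "y + 2 dvd 2 ^ 2 ^ n + 1"
    using add_2_dvd_even_power_plus_1_iff[of "2 ^ n" y] assms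
    by (metis dvd_triv_left even_power even_numeral)
  have quot: "x (n + 6) = (y ^ 2 ^ n + 1) div (y + 2)"
    by (simp only: last[symmetric] nonzero_mult_div_cancel_left)
  have "x = fermat_tuple n y"
  proof (rule PiE_ext[OF ext])
    show "fermat_tuple n y \<in> {1..n + 6} \<rightarrow>\<^sub>E UNIV"
      by (simp add: fermat_tuple_def)
    fix i assume "i \<in> {1..n + 6}"
    then show "x i = fermat_tuple n y i"
    proof (cases rule: fermat_index_cases)
      case 1
      then have "i - 1 \<le> n" "i - 1 + 1 = i" by auto
      with 1 pow[of "i - 1"] show ?thesis by (simp only: fermat_tuple_simps(1))
    qed (simp_all only: vals quot fermat_tuple_simps)
  qed
  with dvd show "x \<in> fermat_tuple n ` {y. y + 2 dvd 2 ^ 2 ^ n + 1}"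
    by blast
qed (use assms fermat_tuple_in_fermat_solutions in blast)

text \<open>A divisor of a positive number is at most that number, so y + 2 \<le> y^(2^n) + 1. This
  bounds the entries \<open>n + 3\<close> and \<open>n + 4\<close> and makes the quotient in the
  last entry positive. The powers of y increase with the exponent.\<close>

lemma fermat_tuple_bounds:
  assumes "n > 0" "y \<ge> 2" "y + 2 dvd 2 ^ 2 ^ n + 1" "i \<in> {1..n + 6}"
  shows "0 < fermat_tuple n y i \<and> fermat_tuple n y i \<le> y ^ 2 ^ n + 1"
proof -
  have "y + 2 dvd y ^ 2 ^ n + 1"
    using assms by (subst add_2_dvd_even_power_plus_1_iff) auto
  then have le: "y + 2 \<le> y ^ 2 ^ n + 1"
    by (rule dvd_imp_le) simp
  show ?thesis
    using assms(4)
  proof (cases rule: fermat_index_cases)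
    case 1
    then have "y ^ 2 ^ (i - 1) \<le> y ^ 2 ^ n"
      using assms(2) by (intro power_increasing) auto
    then have "y ^ 2 ^ (i - 1) \<le> y ^ 2 ^ n + 1"
      by (rule trans_le_add1)
    with assms(2) show ?thesis
      by (simp only: fermat_tuple_simps(1)[OF 1]) (metis zero_less_power zero_less_numeral less_le_trans)
  next
    case 6
    have "0 < (y ^ 2 ^ n + 1) div (y + 2)"
      using le by (simp add: div_greater_zero_iff)
    then show ?thesis
      unfolding 6 fermat_tuple_simps using div_le_dividend by blast
  qed (use le in \<open>simp_all only: fermat_tuple_simps, simp_all\<close>)
qed

theorem theorem3:
  fixes n :: nat
  assumes "n > 0" and "prime ((2::nat) ^ 2 ^ n + 1)"
  shows "(\<exists>!a. a \<in> fermat_solutions n) \<and>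
    (\<forall>a\<in>fermat_solutions n.
       (\<forall>i\<in>{1..n + 6}. a i > 0) \<and>
       Max (a ` {1..n + 6}) = a (n + 5) \<and>
       a (n + 5) = (2 ^ 2 ^ n - 1) ^ 2 ^ n + 1)"
proof -
  define y :: nat where "y = 2 ^ 2 ^ n - 1"
  \<comment> \<open>The Fermat exponent is at least 2, so the subtraction defining \<open>y\<close>
    does not truncate and \<open>y\<close> is large enough for the bounds.\<close>
  have "(2::nat) ^ 2 \<le> 2 ^ 2 ^ n"
    using assms(1) self_le_power[of "2::nat" n] by (intro power_increasing) auto
  then have y: "y + 2 = 2 ^ 2 ^ n + 1" "y \<ge> 2"
    by (auto simp: y_def)
  have "z + 2 dvd 2 ^ 2 ^ n + 1 \<longleftrightarrow> z = y" for z
  proof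
    assume "z + 2 dvd 2 ^ 2 ^ n + 1"
    then have "z + 2 = 1 \<or> z + 2 = 2 ^ 2 ^ n + 1"
      using assms(2) by (metis prime_nat_iff)
    then show "z = y" using y(1) by simp
  qed (simp only: y(1) dvd_refl)
  then have sol: "fermat_solutions n = {fermat_tuple n y}"
    by (simp only: fermat_solutions_eq[OF assms(1)]) simp
  have bounds: "0 < fermat_tuple n y i \<and> fermat_tuple n y i \<le> fermat_tuple n y (n + 5)"
    if "i \<in> {1..n + 6}" for i
    using fermat_tuple_bounds[OF assms(1) y(2) _ that] y(1)
    by (simp only: fermat_tuple_simps(5) dvd_refl)
  then have "Max (fermat_tuple n y ` {1..n + 6}) = fermat_tuple n y (n + 5)"
    by (intro Max_eqI) auto
  with bounds show ?thesis
    unfolding sol using fermat_tuple_simps(5)[of n y] by (simp add: y_def)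
qed

end
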